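(* Let $G=(V,E)$ be a finite connected simple graph, let $w:E\to(0,\infty)$ be a positive edge weight, and let $e=xy\in E$. Then $$\kappa_{\mathrm{LLY}}^w(e)\le 1+\frac12 q_e^w-\frac12\eta_e(w).$$ In particular, $\kappa_{\mathrm{LLY}}^w(e)\le 1+q_e^w/2$. If, moreover, a nonempty set $F\subseteq E$ satisfies $\frac{2|F|}{|V(F)|}=\operatorname{mad}(G)$, then, with $H_F=(V(F),F)$, one has $$L_{H_F}(w)+\sum_{e\in F}\eta_e(w)\le 2|F|\Bigl(1+\frac{1}{\operatorname{mad}(G)}-\kappa_{\mathrm{LLY}}^w(G)\Bigr).$$ Consequently, if $\kappa_{\max}^{\mathrm{LLY}}(G)=1+\frac{1}{\operatorname{mad}(G)}$ and $\{w^{(j)}\}_{j\ge1}$ is a maximizing sequence, then $L_{H_F}(w^{(j)})\to0$ and $\eta_e(w^{(j)})\to0$ for every $e\in F$.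
   Context: Graphs are finite, simple and undirected. The maximum average degree is $\operatorname{mad}(G):=\max_{\varnothing\ne H\subseteq G}\frac{2|E(H)|}{|V(H)|}$, the maximum being over nonempty subgraphs $H$ of $G$. For $F\subseteq E$, $V(F)$ is the set of vertices incident with at least one edge of $F$. Lin--Lu--Yau curvature with fixed combinatorial distance: let $G=(V,E)$ be finite and connected with $E\neq\varnothing$, and let $d$ be its combinatorial (shortest-path) distance. A positive edge weight is a function $w:E\to(0,\infty)$; put $d_x^w:=\sum_{z\sim x}w_{xz}$. For $\alpha\in[0,1]$ and $x\in V$ let $\mu_x^{\alpha,w}$ be the probability measure on $V$ with $\mu_x^{\alpha,w}(x)=\alpha$, $\mu_x^{\alpha,w}(z)=(1-\alpha)w_{xz}/d_x^w$ if $z\sim x$, and $\mu_x^{\alpha,w}(z)=0$ otherwise. Let $W_1$ be the $1$-Wasserstein distance with respect to $d$ (independent of $w$). For an edge $e=xy$, put $\kappa_\alpha^w(x,y):=1-W_1(\mu_x^{\alpha,w},\mu_y^{\alpha,w})$ and $$\kappa_{\mathrm{LLY}}^w(e)=\kappa_{\mathrm{LLY}}^w(x,y):=\lim_{\alpha\to1^-}\frac{\kappa_\alpha^w(x,y)}{1-\alpha}.$$ Put $\kappa_{\mathrm{LLY}}^w(G):=\min_{e\in E}\kappa_{\mathrm{LLY}}^w(e)$ and $\kappa_{\max}^{\mathrm{LLY}}(G):=\sup_{w:E\to(0,\infty)}\kappa_{\mathrm{LLY}}^w(G)$. A maximizing sequence is a sequence of positive edge weights $w^{(j)}$ with $\kappa_{\mathrm{LLY}}^{w^{(j)}}(G)\to\kappa_{\max}^{\mathrm{LLY}}(G)$.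 For an edge $e=xy$: $q_e^w:=\frac{w_{xy}}{d_x^w}+\frac{w_{xy}}{d_y^w}$, and the triangle defect is $$\eta_e(w):=\sum_{\substack{u\sim x,\ u\ne y\\ u\not\sim y}}\frac{w_{xu}}{d_x^w}+\sum_{\substack{v\sim y,\ v\ne x\\ v\not\sim x}}\frac{w_{yv}}{d_y^w}.$$ For a finite nonempty subgraph $H\subseteq G$, the leakage is $L_H(w):=\sum_{x\in V(H)}\sum_{e\ni x,\ e\notin E(H)}\frac{w_e}{d_x^w}$, where $e$ ranges over edges of $G$. *)

theory Defs
  imports "HOL-Probability.Probability"
begin

text \<open>
  A graph is given by its vertex set \<open>V\<close> and its set \<open>E\<close> of edges, an edge being the
  two-element set of its endpoints. In a simple graph, \<open>{x, y} \<in> E\<close> therefore says that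
  \<open>x\<close> and \<open>y\<close> are adjacent (in particular distinct). Edge weights are functions on edges;
  only their values on \<open>E\<close> matter.
\<close>

definition simple_graph :: "'a set \<Rightarrow> 'a set set \<Rightarrow> bool" where
  "simple_graph V E \<longleftrightarrow> finite V \<and> (\<forall>e\<in>E. e \<subseteq> V \<and> card e = 2)"

definition adjacency :: "'a set set \<Rightarrow> ('a \<times> 'a) set" where
  "adjacency E = {(x, y). {x, y} \<in> E}"

definition graph_connected :: "'a set \<Rightarrow> 'a set set \<Rightarrow> bool" where
  "graph_connected V E \<longleftrightarrow> V \<noteq> {} \<and> (\<forall>x\<in>V. \<forall>y\<in>V. (x, y) \<in> (adjacency E)\<^sup>*)"

text \<open>
  \<open>(x, y) \<in> adjacency E ^^ n\<close> says that there is a walk with \<open>n\<close> edges from \<open>x\<close> to \<open>y\<close>. The value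
  of \<open>graph_dist\<close> is unspecified for vertices in different components.
\<close>

definition graph_dist :: "'a set set \<Rightarrow> 'a \<Rightarrow> 'a \<Rightarrow> nat" where
  "graph_dist E x y = (LEAST n. (x, y) \<in> adjacency E ^^ n)"

definition mad :: "'a set \<Rightarrow> 'a set set \<Rightarrow> real" where
  "mad V E = Max {2 * real (card D) / real (card U) | U D.
     U \<noteq> {} \<and> U \<subseteq> V \<and> D \<subseteq> E \<and> (\<forall>e\<in>D. e \<subseteq> U)}"

definition positive_weight :: "'a set set \<Rightarrow> ('a set \<Rightarrow> real) \<Rightarrow> bool" where
  "positive_weight E w \<longleftrightarrow> (\<forall>e\<in>E. 0 < w e)"

definition wdegree :: "'a set set \<Rightarrow> ('a set \<Rightarrow> real) \<Rightarrow> 'a \<Rightarrow> real" where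
  "wdegree E w x = (\<Sum>z | {x, z} \<in> E. w {x, z})"

definition walk_mass :: "'a set set \<Rightarrow> ('a set \<Rightarrow> real) \<Rightarrow> real \<Rightarrow> 'a \<Rightarrow> 'a \<Rightarrow> real" where
  "walk_mass E w \<alpha> x z =
     (if z = x then \<alpha> else if {x, z} \<in> E then (1 - \<alpha>) * w {x, z} / wdegree E w x else 0)"

text \<open>
  \<open>embed_pmf\<close> turns a mass function into a probability measure; it is meaningful only if the
  masses are nonnegative with total 1, see \<open>pmf_walk_measure\<close> below.
\<close>

definition walk_measure :: "'a set set \<Rightarrow> ('a set \<Rightarrow> real) \<Rightarrow> real \<Rightarrow> 'a \<Rightarrow> 'a pmf" where
  "walk_measure E w \<alpha> x = embed_pmf (walk_mass E w \<alpha> x)"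

definition couplings :: "'a pmf \<Rightarrow> 'a pmf \<Rightarrow> ('a \<times> 'a) pmf set" where
  "couplings \<mu> \<nu> = {\<pi>. map_pmf fst \<pi> = \<mu> \<and> map_pmf snd \<pi> = \<nu>}"

definition wasserstein1 :: "('a \<Rightarrow> 'a \<Rightarrow> real) \<Rightarrow> 'a pmf \<Rightarrow> 'a pmf \<Rightarrow> real" where
  "wasserstein1 d \<mu> \<nu> =
     (INF \<pi>\<in>couplings \<mu> \<nu>. measure_pmf.expectation \<pi> (\<lambda>(a, b). d a b))"

definition kappa_alpha :: "'a set set \<Rightarrow> ('a set \<Rightarrow> real) \<Rightarrow> real \<Rightarrow> 'a \<Rightarrow> 'a \<Rightarrow> real" where
  "kappa_alpha E w \<alpha> x y =
     1 - wasserstein1 (\<lambda>a b. real (graph_dist E a b))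
           (walk_measure E w \<alpha> x) (walk_measure E w \<alpha> y)"

definition kappa_LLY :: "'a set set \<Rightarrow> ('a set \<Rightarrow> real) \<Rightarrow> 'a \<Rightarrow> 'a \<Rightarrow> real" where
  "kappa_LLY E w x y = Lim (at_left 1) (\<lambda>\<alpha>. kappa_alpha E w \<alpha> x y / (1 - \<alpha>))"

text \<open>
  The value of a symmetric function of two vertices at an edge \<open>e = {x, y}\<close>. The curvature,
  \<open>q\<close> and the triangle defect are symmetric, see the lemmas below.
\<close>

definition on_edge :: "('a \<Rightarrow> 'a \<Rightarrow> real) \<Rightarrow> 'a set \<Rightarrow> real" where
  "on_edge f e = (THE r. \<forall>x y. e = {x, y} \<longrightarrow> f x y = r)"

definition kappa_LLY_edge :: "'a set set \<Rightarrow> ('a set \<Rightarrow> real) \<Rightarrow> 'a set \<Rightarrow> real" where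
  "kappa_LLY_edge E w e = on_edge (kappa_LLY E w) e"

definition kappa_LLY_graph :: "'a set set \<Rightarrow> ('a set \<Rightarrow> real) \<Rightarrow> real" where
  "kappa_LLY_graph E w = Min (kappa_LLY_edge E w ` E)"

definition kappa_LLY_max :: "'a set set \<Rightarrow> real" where
  "kappa_LLY_max E = (SUP w\<in>{w. positive_weight E w}. kappa_LLY_graph E w)"

definition maximizing_sequence :: "'a set set \<Rightarrow> (nat \<Rightarrow> 'a set \<Rightarrow> real) \<Rightarrow> bool" where
  "maximizing_sequence E ws \<longleftrightarrow>
     (\<forall>j. positive_weight E (ws j)) \<and>
     (\<lambda>j. kappa_LLY_graph E (ws j)) \<longlonglongrightarrow> kappa_LLY_max E"

definition q_pair :: "'a set set \<Rightarrow> ('a set \<Rightarrow> real) \<Rightarrow> 'a \<Rightarrow> 'a \<Rightarrow> real" where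
  "q_pair E w x y = w {x, y} / wdegree E w x + w {x, y} / wdegree E w y"

definition q_edge :: "'a set set \<Rightarrow> ('a set \<Rightarrow> real) \<Rightarrow> 'a set \<Rightarrow> real" where
  "q_edge E w e = on_edge (q_pair E w) e"

definition triangle_defect_pair :: "'a set set \<Rightarrow> ('a set \<Rightarrow> real) \<Rightarrow> 'a \<Rightarrow> 'a \<Rightarrow> real" where
  "triangle_defect_pair E w x y =
     (\<Sum>u | {u, x} \<in> E \<and> u \<noteq> y \<and> {u, y} \<notin> E. w {x, u} / wdegree E w x) +
     (\<Sum>v | {v, y} \<in> E \<and> v \<noteq> x \<and> {v, x} \<notin> E. w {y, v} / wdegree E w y)"

definition triangle_defect :: "'a set set \<Rightarrow> ('a set \<Rightarrow> real) \<Rightarrow> 'a set \<Rightarrow> real" where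
  "triangle_defect E w e = on_edge (triangle_defect_pair E w) e"

text \<open>Here \<open>E\<close> is the edge set of the ambient graph and \<open>(U, D)\<close> is the subgraph.\<close>

definition leakage :: "'a set set \<Rightarrow> 'a set \<Rightarrow> 'a set set \<Rightarrow> ('a set \<Rightarrow> real) \<Rightarrow> real" where
  "leakage E U D w = (\<Sum>x\<in>U. \<Sum>e | e \<in> E \<and> x \<in> e \<and> e \<notin> D. w e / wdegree E w x)"

lemma on_edge_eq:
  assumes "f x y = f y x"
  shows "on_edge f {x, y} = f x y"
  unfolding on_edge_def
  by (rule the_equality) (use assms in \<open>auto simp: doubleton_eq_iff\<close>)

lemma q_edge_eq: "q_edge E w {x, y} = q_pair E w x y"
  unfolding q_edge_def by (rule on_edge_eq) (simp add: q_pair_def insert_commute)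

lemma triangle_defect_eq: "triangle_defect E w {x, y} = triangle_defect_pair E w x y"
  unfolding triangle_defect_def by (rule on_edge_eq) (simp add: triangle_defect_pair_def)

lemma adjacency_relpow_sym: "(x, y) \<in> adjacency E ^^ n \<Longrightarrow> (y, x) \<in> adjacency E ^^ n"
proof (induction n arbitrary: y)
  case (Suc n)
  then obtain z where "(x, z) \<in> adjacency E ^^ n" "(z, y) \<in> adjacency E" by auto
  then show ?case using Suc.IH
    by (intro relpow_Suc_I2[of y z]) (auto simp: adjacency_def insert_commute)
qed simp

lemma graph_dist_sym: "graph_dist E x y = graph_dist E y x"
proof -
  have "(x, y) \<in> adjacency E ^^ n \<longleftrightarrow> (y, x) \<in> adjacency E ^^ n" for n
    by (rule iffI; erule adjacency_relpow_sym)
  then show ?thesis unfolding graph_dist_def by simp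
qed

lemma wasserstein1_sym:
  assumes "\<And>a b. d a b = d b a"
  shows "wasserstein1 d \<mu> \<nu> = wasserstein1 d \<nu> \<mu>"
proof -
  have swap: "map_pmf prod.swap \<pi> \<in> couplings \<nu> \<mu>" if "\<pi> \<in> couplings \<mu> \<nu>"
    for \<pi> and \<mu> \<nu> :: "'a pmf"
    using that by (auto simp: couplings_def pmf.map_comp comp_def)
  have swap_swap: "map_pmf prod.swap (map_pmf prod.swap \<pi>) = \<pi>" for \<pi> :: "('a \<times> 'a) pmf"
    by (simp add: pmf.map_comp)
  have "couplings \<nu> \<mu> = map_pmf prod.swap ` couplings \<mu> \<nu>"
  proof (intro equalityI subsetI)
    fix \<pi> assume "\<pi> \<in> couplings \<nu> \<mu>"
    then show "\<pi> \<in> map_pmf prod.swap ` couplings \<mu> \<nu>"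
      by (intro image_eqI[of _ _ "map_pmf prod.swap \<pi>"] swap) (simp add: swap_swap)
  qed (use swap in blast)
  then show ?thesis
    using assms by (simp add: wasserstein1_def image_image case_prod_unfold)
qed

lemma kappa_LLY_edge_eq: "kappa_LLY_edge E w {x, y} = kappa_LLY E w x y"
proof -
  have "kappa_alpha E w \<alpha> x y = kappa_alpha E w \<alpha> y x" for \<alpha>
    unfolding kappa_alpha_def by (subst wasserstein1_sym) (simp_all add: graph_dist_sym)
  then show ?thesis
    unfolding kappa_LLY_edge_def by (intro on_edge_eq) (simp add: kappa_LLY_def)
qed

lemma pmf_walk_measure:
  assumes G: "simple_graph V E" and w: "positive_weight E w"
    and xy: "{x, y} \<in> E" and \<alpha>: "0 \<le> \<alpha>" "\<alpha> \<le> 1"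
  shows "pmf (walk_measure E w \<alpha> x) z = walk_mass E w \<alpha> x z"
proof -
  define N where "N = {z. {x, z} \<in> E}"
  have N: "z \<in> N \<longleftrightarrow> {x, z} \<in> E" for z by (simp add: N_def)
  have "N \<subseteq> V" using G unfolding simple_graph_def N_def by blast
  then have fin: "finite N" using G finite_subset unfolding simple_graph_def by blast
  have "card {x, x} \<noteq> 2" by simp
  then have x: "x \<notin> N" using G unfolding simple_graph_def N by blast
  have wpos: "0 < w {x, z}" if "z \<in> N" for z
    using w that unfolding positive_weight_def N by blast
  have deg: "wdegree E w x = (\<Sum>z\<in>N. w {x, z})" by (simp add: wdegree_def N_def)
  have pos: "0 < wdegree E w x"
    unfolding deg using fin xy wpos N by (intro sum_pos) blast+
  have mass: "walk_mass E w \<alpha> x z = (1 - \<alpha>) / wdegree E w x * w {x, z}" if "z \<in> N" for z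
    using that x by (auto simp: walk_mass_def N)
  have mass0: "walk_mass E w \<alpha> x z = 0" if "z \<notin> insert x N" for z
    using that by (simp add: walk_mass_def N)
  have mass_x: "walk_mass E w \<alpha> x x = \<alpha>" by (simp add: walk_mass_def)
  have nonneg: "0 \<le> walk_mass E w \<alpha> x z" for z
  proof (cases "z \<in> N")
    case True
    then show ?thesis unfolding mass[OF True] using \<alpha> pos wpos[OF True] by simp
  next
    case False
    then show ?thesis using mass0 mass_x \<alpha> by (cases "z = x") simp_all
  qed
  have "(\<Sum>z\<in>N. walk_mass E w \<alpha> x z) = (\<Sum>z\<in>N. (1 - \<alpha>) / wdegree E w x * w {x, z})"
    by (rule sum.cong[OF refl mass])
  also have "\<dots> = (1 - \<alpha>) / wdegree E w x * wdegree E w x"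
    unfolding deg by (rule sum_distrib_left[symmetric])
  also have "\<dots> = 1 - \<alpha>" using pos by simp
  finally have total: "(\<Sum>z\<in>insert x N. walk_mass E w \<alpha> x z) = 1"
    using fin x mass_x by simp
  have "(\<integral>\<^sup>+z. ennreal (walk_mass E w \<alpha> x z) \<partial>count_space UNIV) =
      (\<Sum>z\<in>insert x N. ennreal (walk_mass E w \<alpha> x z))"
    by (rule nn_integral_count_space') (use fin mass0 in simp_all)
  also have "\<dots> = 1"
    using total nonneg by (simp only: sum_ennreal ennreal_1)
  finally show ?thesis
    unfolding walk_measure_def using nonneg by (intro pmf_embed_pmf)
qed

end

theory Submission
  imports Defs
begin

text \<open>
  The curvature estimate is the easy half of Kantorovich duality, applied to a test function
  that is made for the edge \<open>xy\<close>: it is \<open>1/2\<close> at \<open>x\<close> and at the neighbours that \<open>x\<close> does not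
  share with \<open>y\<close>, \<open>-1/2\<close> at \<open>y\<close> and at the neighbours that \<open>y\<close> does not share with \<open>x\<close>, and \<open>0\<close>
  elsewhere. Its values lie in \<open>[-1/2, 1/2]\<close> and distinct vertices are at distance at least 1, so
  it is 1-Lipschitz. Integrating it against the two walk measures gives
  \<open>\<kappa>\<^sub>\<alpha>(x, y) \<le> (1 - \<alpha>) (1 + q\<^sub>e / 2 - \<eta>\<^sub>e / 2)\<close> for every \<open>\<alpha>\<close>
  (\<open>kappa_alpha_le\<close>).

  To carry this bound to \<open>\<alpha> \<rightarrow> 1\<close> the limit defining the curvature must be known to exist. The walk
  measure with larger idleness is a mixture of the one with smaller idleness and the point mass
  at the starting vertex; mixing a coupling with the pair \<open>(x, y)\<close>, which costs 1, shows that
  \<open>\<kappa>\<^sub>\<alpha> / (1 - \<alpha>)\<close> does not decrease as \<open>\<alpha>\<close> grows (\<open>kappa_alpha_quotient_mono\<close>). Being bounded above by the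
  same estimate, it converges.

  For the inequality on \<open>F\<close>, sum the edge estimate over \<open>F\<close>. Each of the summands \<open>w\<^sub>e / d\<^sub>x\<close> of
  \<open>\<Sum>\<^sub>e q\<^sub>e\<close> is a transition probability out of a vertex \<open>x\<close> of \<open>V(F)\<close>, and those out of \<open>x\<close>
  add up to 1 except for what leaks out of \<open>F\<close>. Hence the sum is \<open>\<bar>V(F)\<bar>\<close> minus the leakage
  (\<open>sum_q_edge\<close>), and \<open>\<bar>V(F)\<bar> = 2\<bar>F\<bar> / mad\<close> by the choice of \<open>F\<close>. Leakage and defects are
  nonnegative, so along a maximizing sequence they are squeezed to 0.
\<close>

section \<open>Estimates for the Wasserstein distance\<close>

lemma finite_set_pmf_coupling:
  assumes "\<pi> \<in> couplings \<mu> \<nu>" "finite (set_pmf \<mu>)" "finite (set_pmf \<nu>)"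
  shows "finite (set_pmf \<pi>)"
proof (rule finite_subset)
  show "set_pmf \<pi> \<subseteq> set_pmf \<mu> \<times> set_pmf \<nu>"
    using assms(1) by (force simp: couplings_def)
qed (use assms in simp)

lemma couplings_nonempty: "couplings \<mu> \<nu> \<noteq> {}"
proof -
  have "pair_pmf \<mu> \<nu> \<in> couplings \<mu> \<nu>"
    by (simp add: couplings_def map_fst_pair_pmf map_snd_pair_pmf)
  then show ?thesis by blast
qed

lemma bdd_below_transport_cost:
  fixes d :: "'a \<Rightarrow> 'a \<Rightarrow> real"
  assumes "\<And>a b. 0 \<le> d a b"
  shows "bdd_below ((\<lambda>\<pi>. measure_pmf.expectation \<pi> (\<lambda>(a, b). d a b)) ` S)"
proof (rule bdd_belowI2)
  show "0 \<le> measure_pmf.expectation \<pi> (\<lambda>(a, b). d a b)" for \<pi>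
    using assms by (intro Bochner_Integration.integral_nonneg) auto
qed

text \<open>
  Weak Kantorovich duality for the test function \<open>(indicator A - indicator B) / 2\<close>: it varies by
  at most 1, hence by at most the distance between two distinct points.
\<close>

lemma wasserstein1_ge_disjoint:
  assumes sep: "\<And>a b. a \<in> set_pmf \<mu> \<Longrightarrow> b \<in> set_pmf \<nu> \<Longrightarrow> a \<noteq> b \<Longrightarrow> 1 \<le> d a b"
    and nonneg: "\<And>a b. 0 \<le> d a b"
    and fin: "finite (set_pmf \<mu>)" "finite (set_pmf \<nu>)"
    and disj: "A \<inter> B = {}"
  shows "(measure_pmf.prob \<mu> A - measure_pmf.prob \<mu> B
          + measure_pmf.prob \<nu> B - measure_pmf.prob \<nu> A) / 2 \<le> wasserstein1 d \<mu> \<nu>"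
  unfolding wasserstein1_def
proof (rule cINF_greatest[OF couplings_nonempty])
  fix \<pi> assume \<pi>: "\<pi> \<in> couplings \<mu> \<nu>"
  define f :: "'a \<Rightarrow> real" where "f a = (indicator A a - indicator B a) / 2" for a
  have int: "integrable \<pi> g" for g :: "_ \<Rightarrow> real"
    by (rule integrable_measure_pmf_finite[OF finite_set_pmf_coupling[OF \<pi> fin]])
  have f_int: "measure_pmf.expectation p f = (measure_pmf.prob p A - measure_pmf.prob p B) / 2" for p
  proof -
    have "integrable (measure_pmf p) (indicator S :: _ \<Rightarrow> real)" for S
      by (rule integrable_real_indicator) (auto simp: measure_pmf.emeasure_eq_measure)
    then show ?thesis unfolding f_def by simp
  qed
  have \<mu>: "\<mu> = map_pmf fst \<pi>" and \<nu>: "\<nu> = map_pmf snd \<pi>"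
    using \<pi> by (auto simp: couplings_def)
  have "(measure_pmf.prob \<mu> A - measure_pmf.prob \<mu> B
          + measure_pmf.prob \<nu> B - measure_pmf.prob \<nu> A) / 2
      = measure_pmf.expectation \<mu> f - measure_pmf.expectation \<nu> f"
    unfolding f_int by (simp add: field_simps)
  also have "\<dots> = measure_pmf.expectation \<pi> (\<lambda>ab. f (fst ab) - f (snd ab))"
    unfolding \<mu> \<nu> integral_map_pmf by (rule Bochner_Integration.integral_diff[OF int int, symmetric])
  also have "\<dots> \<le> measure_pmf.expectation \<pi> (\<lambda>(a, b). d a b)"
  proof (intro integral_mono_AE int AE_pmfI)
    fix ab assume ab: "ab \<in> set_pmf \<pi>"
    obtain a b where [simp]: "ab = (a, b)" by (cases ab)
    have "a \<in> set_pmf \<mu>" "b \<in> set_pmf \<nu>" using ab by (force simp: \<mu> \<nu>)+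
    then have "f a - f b \<le> d a b"
      using sep[of a b] nonneg[of a b] disj
      by (cases "a = b") (auto simp: f_def indicator_def)
    then show "f (fst ab) - f (snd ab) \<le> (case ab of (a, b) \<Rightarrow> d a b)" by simp
  qed
  finally show "(measure_pmf.prob \<mu> A - measure_pmf.prob \<mu> B
          + measure_pmf.prob \<nu> B - measure_pmf.prob \<nu> A) / 2
      \<le> measure_pmf.expectation \<pi> (\<lambda>(a, b). d a b)" .
qed

definition point_mixture :: "real \<Rightarrow> 'b pmf \<Rightarrow> 'b \<Rightarrow> 'b pmf" where
  "point_mixture t p z = bind_pmf (bernoulli_pmf t) (\<lambda>b. if b then p else return_pmf z)"

lemma pmf_point_mixture:
  assumes "0 \<le> t" "t \<le> 1"
  shows "pmf (point_mixture t p z) i = t * pmf p i + (1 - t) * indicator {i} z"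
  using assms by (simp add: point_mixture_def pmf_bind)

lemma map_point_mixture: "map_pmf f (point_mixture t p z) = point_mixture t (map_pmf f p) (f z)"
  unfolding point_mixture_def map_bind_pmf
  by (intro bind_pmf_cong refl) simp

lemma expectation_point_mixture:
  fixes h :: "'b \<Rightarrow> real"
  assumes "0 \<le> t" "t \<le> 1" "finite (set_pmf p)"
  shows "measure_pmf.expectation (point_mixture t p z) h
      = t * measure_pmf.expectation p h + (1 - t) * h z"
  using assms unfolding point_mixture_def
  by (subst pmf_expectation_bind[where A = UNIV]) (auto simp: UNIV_bool)

text \<open>
  The mixture of an arbitrary coupling with the pair \<open>(x, y)\<close> couples the two mixtures, and its
  cost is the corresponding convex combination.
\<close>

lemma wasserstein1_point_mixture_le:
  assumes t: "0 < t" "t \<le> 1"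
    and nonneg: "\<And>a b. 0 \<le> d a b"
    and fin: "finite (set_pmf \<mu>)" "finite (set_pmf \<nu>)"
  shows "wasserstein1 d (point_mixture t \<mu> x) (point_mixture t \<nu> y)
      \<le> t * wasserstein1 d \<mu> \<nu> + (1 - t) * d x y"
proof -
  let ?c = "\<lambda>\<pi>. measure_pmf.expectation \<pi> (\<lambda>(a, b). d a b)"
  let ?W = "wasserstein1 d (point_mixture t \<mu> x) (point_mixture t \<nu> y)"
  have "(?W - (1 - t) * d x y) / t \<le> ?c \<pi>" if \<pi>: "\<pi> \<in> couplings \<mu> \<nu>" for \<pi>
  proof -
    have "point_mixture t \<pi> (x, y) \<in> couplings (point_mixture t \<mu> x) (point_mixture t \<nu> y)"
      using \<pi> by (auto simp: couplings_def map_point_mixture)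
    then have "?W \<le> ?c (point_mixture t \<pi> (x, y))"
      unfolding wasserstein1_def
      by (intro cINF_lower bdd_below_transport_cost nonneg)
    also have "\<dots> = t * ?c \<pi> + (1 - t) * d x y"
      using t finite_set_pmf_coupling[OF \<pi> fin] by (subst expectation_point_mixture) auto
    finally show ?thesis using t by (simp add: field_simps)
  qed
  then have "(?W - (1 - t) * d x y) / t \<le> wasserstein1 d \<mu> \<nu>"
    unfolding wasserstein1_def[of d \<mu> \<nu>] by (intro cINF_greatest couplings_nonempty)
  then show ?thesis using t by (simp add: field_simps)
qed

section \<open>Weighted simple graphs\<close>

lemma graph_dist_ge_1:
  assumes "graph_connected V E" "a \<in> V" "b \<in> V" "a \<noteq> b"
  shows "1 \<le> graph_dist E a b"
proof -
  have "\<exists>n. (a, b) \<in> adjacency E ^^ n"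
    using assms by (auto simp: graph_connected_def rtrancl_power)
  then have "(a, b) \<in> adjacency E ^^ graph_dist E a b"
    unfolding graph_dist_def by (rule LeastI_ex)
  with \<open>a \<noteq> b\<close> show ?thesis by (cases "graph_dist E a b") auto
qed

lemma graph_dist_edge_le_1:
  assumes "{x, y} \<in> E"
  shows "graph_dist E x y \<le> 1"
  unfolding graph_dist_def
  by (rule Least_le) (use assms in \<open>simp add: adjacency_def\<close>)

lemma edge_distinct:
  assumes "simple_graph V E" "{x, y} \<in> E"
  shows "x \<noteq> y"
proof
  assume "x = y"
  moreover have "card {x, y} = 2" using assms by (auto simp: simple_graph_def)
  ultimately show False by simp
qed

lemma edge_vertices:
  assumes "simple_graph V E" "{x, y} \<in> E"
  shows "x \<in> V" "y \<in> V"
  using assms unfolding simple_graph_def by blast+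

lemma finite_neighbours:
  assumes "simple_graph V E"
  shows "finite {z. {x, z} \<in> E}"
proof (rule finite_subset)
  show "{z. {x, z} \<in> E} \<subseteq> V" using edge_vertices[OF assms] by blast
qed (use assms in \<open>simp add: simple_graph_def\<close>)

lemma finite_edges:
  assumes "simple_graph V E"
  shows "finite E"
proof (rule finite_subset)
  show "E \<subseteq> Pow V" using assms by (auto simp: simple_graph_def)
qed (use assms in \<open>simp add: simple_graph_def\<close>)

lemma edgeE:
  assumes "simple_graph V E" "e \<in> E"
  obtains x y where "e = {x, y}" "x \<noteq> y"
proof -
  have "card e = 2" using assms by (auto simp: simple_graph_def)
  then show ?thesis using that by (auto simp: card_2_iff)
qed

lemma wdegree_pos:
  assumes "simple_graph V E" "positive_weight E w" "{x, y} \<in> E"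
  shows "0 < wdegree E w x"
  unfolding wdegree_def
  using assms finite_neighbours[OF assms(1), of x]
  by (intro sum_pos) (auto simp: positive_weight_def)

lemma wdegree_nonneg:
  assumes "positive_weight E w"
  shows "0 \<le> wdegree E w x"
  unfolding wdegree_def
  using assms by (intro sum_nonneg) (auto simp: positive_weight_def less_imp_le)

lemma q_edge_eq_sum:
  assumes "simple_graph V E" "e \<in> E"
  shows "q_edge E w e = (\<Sum>x\<in>e. w e / wdegree E w x)"
  using assms(1,2) by (rule edgeE) (simp add: q_edge_eq q_pair_def)

lemma triangle_defect_nonneg:
  assumes "simple_graph V E" "positive_weight E w" "e \<in> E"
  shows "0 \<le> triangle_defect E w e"
proof -
  obtain x y where e: "e = {x, y}" using assms(1,3) by (rule edgeE)
  have "0 \<le> w {a, b} / wdegree E w a" if "{b, a} \<in> E" for a b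
  proof (rule divide_nonneg_nonneg)
    show "0 \<le> w {a, b}"
      using assms(2) that by (auto simp: positive_weight_def insert_commute intro: less_imp_le)
  qed (rule wdegree_nonneg[OF assms(2)])
  then show ?thesis
    unfolding e triangle_defect_eq triangle_defect_pair_def
    by (intro add_nonneg_nonneg sum_nonneg) auto
qed

lemma leakage_nonneg:
  assumes "positive_weight E w"
  shows "0 \<le> leakage E U D w"
  unfolding leakage_def
  using assms wdegree_nonneg[OF assms]
  by (intro sum_nonneg divide_nonneg_nonneg) (auto simp: positive_weight_def less_imp_le)

lemma set_pmf_walk_measure_subset:
  assumes "simple_graph V E" "positive_weight E w" "{x, y} \<in> E" "0 \<le> \<alpha>" "\<alpha> \<le> 1"
  shows "set_pmf (walk_measure E w \<alpha> x) \<subseteq> V"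
  using edge_vertices[OF assms(1)] assms(3)
  by (auto simp: set_pmf_iff pmf_walk_measure[OF assms] walk_mass_def split: if_splits)

lemma finite_set_pmf_walk_measure:
  assumes "simple_graph V E" "positive_weight E w" "{x, y} \<in> E" "0 \<le> \<alpha>" "\<alpha> \<le> 1"
  shows "finite (set_pmf (walk_measure E w \<alpha> x))"
  using set_pmf_walk_measure_subset[OF assms] assms(1)
  by (auto simp: simple_graph_def intro: finite_subset)

section \<open>The curvature of an edge\<close>

text \<open>
  The set on which the test function for the edge \<open>xy\<close> is \<open>1/2\<close>. Exchanging \<open>x\<close> and \<open>y\<close> gives
  the set on which it is \<open>-1/2\<close>.
\<close>

definition private_side :: "'a set set \<Rightarrow> 'a \<Rightarrow> 'a \<Rightarrow> 'a set" where
  "private_side E x y = insert x {u. {u, x} \<in> E \<and> u \<noteq> y \<and> {u, y} \<notin> E}"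

lemma prob_own_private_side:
  assumes G: "simple_graph V E" and "positive_weight E w" "{x, y} \<in> E" "0 \<le> \<alpha>" "\<alpha> \<le> 1"
  shows "measure_pmf.prob (walk_measure E w \<alpha> x) (private_side E x y) =
    \<alpha> + (1 - \<alpha>) * (\<Sum>u | {u, x} \<in> E \<and> u \<noteq> y \<and> {u, y} \<notin> E. w {x, u} / wdegree E w x)"
proof -
  let ?P = "{u. {u, x} \<in> E \<and> u \<noteq> y \<and> {u, y} \<notin> E}"
  have fin: "finite ?P"
    by (rule finite_subset[OF _ finite_neighbours[OF G, of x]]) (auto simp: insert_commute)
  have notin: "x \<notin> ?P" using edge_distinct[OF G, of x x] by auto
  have mass: "walk_mass E w \<alpha> x u = (1 - \<alpha>) * (w {x, u} / wdegree E w x)" if "u \<in> ?P" for u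
    using that notin by (auto simp: walk_mass_def insert_commute)
  have "measure_pmf.prob (walk_measure E w \<alpha> x) (private_side E x y)
      = walk_mass E w \<alpha> x x + (\<Sum>u\<in>?P. walk_mass E w \<alpha> x u)"
    unfolding private_side_def using fin notin
    by (simp add: measure_measure_pmf_finite pmf_walk_measure[OF assms])
  also have "(\<Sum>u\<in>?P. walk_mass E w \<alpha> x u)
      = (\<Sum>u\<in>?P. (1 - \<alpha>) * (w {x, u} / wdegree E w x))"
    by (rule sum.cong[OF refl mass])
  finally show ?thesis by (simp add: sum_distrib_left walk_mass_def)
qed

text \<open>
  Every neighbour of \<open>x\<close> other than \<open>y\<close> is excluded from the side of \<open>y\<close>, and so is \<open>x\<close> itself.
\<close>

lemma prob_opposite_private_side:
  assumes G: "simple_graph V E" and "positive_weight E w" "{x, y} \<in> E" "0 \<le> \<alpha>" "\<alpha> \<le> 1"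
  shows "measure_pmf.prob (walk_measure E w \<alpha> x) (private_side E y x) =
    (1 - \<alpha>) * (w {x, y} / wdegree E w x)"
proof -
  have xy: "x \<noteq> y" using edge_distinct[OF G] assms(3) .
  have fin: "finite (private_side E y x)"
    unfolding private_side_def
    by (rule finite.insertI, rule finite_subset[OF _ finite_neighbours[OF G, of y]])
       (auto simp: insert_commute)
  have "measure_pmf.prob (walk_measure E w \<alpha> x) (private_side E y x)
      = (\<Sum>z\<in>private_side E y x. walk_mass E w \<alpha> x z)"
    using fin by (simp add: measure_measure_pmf_finite pmf_walk_measure[OF assms])
  also have "\<dots> = (\<Sum>z\<in>{y}. walk_mass E w \<alpha> x z)"
    using fin xy
    by (intro sum.mono_neutral_right) (auto simp: private_side_def walk_mass_def insert_commute)
  finally show ?thesis using xy assms(3) by (simp add: walk_mass_def)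
qed

lemma kappa_alpha_le:
  assumes G: "simple_graph V E" and conn: "graph_connected V E" and w: "positive_weight E w"
    and xy: "{x, y} \<in> E" and \<alpha>: "0 \<le> \<alpha>" "\<alpha> \<le> 1"
  shows "kappa_alpha E w \<alpha> x y
    \<le> (1 - \<alpha>) * (1 + 1/2 * q_pair E w x y - 1/2 * triangle_defect_pair E w x y)"
proof -
  let ?\<mu> = "walk_measure E w \<alpha> x" and ?\<nu> = "walk_measure E w \<alpha> y"
  let ?A = "private_side E x y" and ?B = "private_side E y x"
  have yx: "{y, x} \<in> E" using xy by (simp add: insert_commute)
  have "?A \<inter> ?B = {}"
    using edge_distinct[OF G xy] by (auto simp: private_side_def)
  moreover have "1 \<le> real (graph_dist E a b)"
    if "a \<in> set_pmf ?\<mu>" "b \<in> set_pmf ?\<nu>" "a \<noteq> b" for a b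
    using graph_dist_ge_1[OF conn _ _ that(3)] that(1,2)
      set_pmf_walk_measure_subset[OF G w xy \<alpha>] set_pmf_walk_measure_subset[OF G w yx \<alpha>]
    by fastforce
  ultimately have "(measure_pmf.prob ?\<mu> ?A - measure_pmf.prob ?\<mu> ?B
      + measure_pmf.prob ?\<nu> ?B - measure_pmf.prob ?\<nu> ?A) / 2
    \<le> wasserstein1 (\<lambda>a b. real (graph_dist E a b)) ?\<mu> ?\<nu>"
    using finite_set_pmf_walk_measure[OF G w xy \<alpha>] finite_set_pmf_walk_measure[OF G w yx \<alpha>]
    by (intro wasserstein1_ge_disjoint) auto
  then show ?thesis
    unfolding kappa_alpha_def q_pair_def triangle_defect_pair_def
      prob_own_private_side[OF G w xy \<alpha>] prob_opposite_private_side[OF G w xy \<alpha>]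
      prob_own_private_side[OF G w yx \<alpha>] prob_opposite_private_side[OF G w yx \<alpha>]
    by (simp add: insert_commute[of y x] algebra_simps add_divide_distrib diff_divide_distrib)
qed

text \<open>Raising the idleness amounts to staying at the starting vertex with positive probability.\<close>

lemma walk_measure_point_mixture:
  assumes G: "simple_graph V E" and w: "positive_weight E w" and xy: "{x, y} \<in> E"
    and \<alpha>: "0 \<le> \<alpha>" "\<alpha> \<le> 1" and t: "0 \<le> t" "t \<le> 1"
  shows "point_mixture t (walk_measure E w \<alpha> x) x = walk_measure E w (1 - t * (1 - \<alpha>)) x"
proof -
  have "t * (1 - \<alpha>) \<le> 1 * 1" using \<alpha> t by (intro mult_mono) auto
  then have \<beta>: "0 \<le> 1 - t * (1 - \<alpha>)" "1 - t * (1 - \<alpha>) \<le> 1" using \<alpha> t by auto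
  show ?thesis
    by (rule pmf_eqI, unfold pmf_point_mixture[OF t] pmf_walk_measure[OF G w xy \<alpha>]
          pmf_walk_measure[OF G w xy \<beta>])
       (auto simp: walk_mass_def indicator_def algebra_simps)
qed

lemma kappa_alpha_quotient_mono:
  assumes G: "simple_graph V E" and w: "positive_weight E w" and xy: "{x, y} \<in> E"
    and "0 \<le> \<alpha>" "\<alpha> \<le> \<beta>" "\<beta> < 1"
  shows "kappa_alpha E w \<alpha> x y / (1 - \<alpha>) \<le> kappa_alpha E w \<beta> x y / (1 - \<beta>)"
proof -
  let ?d = "\<lambda>a b. real (graph_dist E a b)"
  let ?W = "\<lambda>\<alpha>. wasserstein1 ?d (walk_measure E w \<alpha> x) (walk_measure E w \<alpha> y)"
  \<comment> \<open>The weight for which mixing turns idleness \<open>\<alpha>\<close> into idleness \<open>\<beta>\<close>.\<close>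
  define t where "t = (1 - \<beta>) / (1 - \<alpha>)"
  have t: "0 < t" "t \<le> 1" using assms by (auto simp: t_def)
  have \<beta>: "1 - t * (1 - \<alpha>) = \<beta>" using assms by (simp add: t_def)
  have yx: "{y, x} \<in> E" using xy by (simp add: insert_commute)
  have \<alpha>: "0 \<le> \<alpha>" "\<alpha> \<le> 1" using assms by auto
  have "?W \<beta> \<le> t * ?W \<alpha> + (1 - t) * ?d x y"
    using wasserstein1_point_mixture_le[OF t, of ?d "walk_measure E w \<alpha> x" "walk_measure E w \<alpha> y" x y]
      finite_set_pmf_walk_measure[OF G w xy \<alpha>] finite_set_pmf_walk_measure[OF G w yx \<alpha>]
      walk_measure_point_mixture[OF G w xy \<alpha>, of t] walk_measure_point_mixture[OF G w yx \<alpha>, of t] t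
    by (simp add: \<beta>)
  also have "\<dots> \<le> t * ?W \<alpha> + (1 - t) * 1"
    using graph_dist_edge_le_1[OF xy] t by (intro add_left_mono mult_left_mono) auto
  finally have "t * kappa_alpha E w \<alpha> x y \<le> kappa_alpha E w \<beta> x y"
    by (simp add: kappa_alpha_def algebra_simps)
  then have "t * kappa_alpha E w \<alpha> x y / (1 - \<beta>) \<le> kappa_alpha E w \<beta> x y / (1 - \<beta>)"
    using assms by (intro divide_right_mono) auto
  moreover have "t * kappa_alpha E w \<alpha> x y / (1 - \<beta>) = kappa_alpha E w \<alpha> x y / (1 - \<alpha>)"
    using assms by (simp add: t_def)
  ultimately show ?thesis by simp
qed

text \<open>
  \<open>Lim\<close> has an unspecified value when there is no limit, so the bound for \<open>\<alpha> < 1\<close> passes to the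
  curvature only together with convergence, which follows from monotonicity.
\<close>

lemma kappa_LLY_edge_le:
  assumes G: "simple_graph V E" and conn: "graph_connected V E" and w: "positive_weight E w"
    and e: "e \<in> E"
  shows "kappa_LLY_edge E w e \<le> 1 + 1/2 * q_edge E w e - 1/2 * triangle_defect E w e"
proof -
  obtain x y where e_def: "e = {x, y}" using G e by (rule edgeE)
  with e have xy: "{x, y} \<in> E" by simp
  let ?h = "\<lambda>\<alpha>. kappa_alpha E w \<alpha> x y / (1 - \<alpha>)"
  let ?B = "1 + 1/2 * q_pair E w x y - 1/2 * triangle_defect_pair E w x y"
  have bound: "?h \<alpha> \<le> ?B" if "0 \<le> \<alpha>" "\<alpha> < 1" for \<alpha>
    using kappa_alpha_le[OF G conn w xy, of \<alpha>] that by (simp add: divide_le_eq mult.commute)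
  \<comment> \<open>Idleness below 0 gives no probability measures, so monotonicity is used on \<open>[0, 1)\<close> only.\<close>
  have "at (1::real) within ({..<1} \<inter> {0..}) = at_left 1"
    by (rule at_within_nhd[where S = "{0<..}"]) auto
  moreover have "(?h \<longlongrightarrow> Sup (?h ` ({..<1} \<inter> {0..}))) (at 1 within ({..<1} \<inter> {0..}))"
    by (rule Lim_left_bound[where K = ?B])
       (use kappa_alpha_quotient_mono[OF G w xy] bound in auto)
  ultimately have lim: "(?h \<longlongrightarrow> Sup (?h ` ({..<1} \<inter> {0..}))) (at_left 1)" by simp
  then have "kappa_LLY E w x y = Sup (?h ` ({..<1} \<inter> {0..}))"
    unfolding kappa_LLY_def by (intro tendsto_Lim) auto
  also have "\<dots> \<le> ?B"
  proof (rule cSUP_least)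
    have "0 \<in> {..<1::real} \<inter> {0..}" by simp
    then show "{..<1::real} \<inter> {0..} \<noteq> {}" by blast
  qed (use bound in auto)
  finally show ?thesis
    by (simp add: e_def kappa_LLY_edge_eq q_edge_eq triangle_defect_eq)
qed

section \<open>Summation over a set of edges\<close>

lemma sum_transition_probabilities:
  assumes G: "simple_graph V E" and w: "positive_weight E w" and "e \<in> E" "x \<in> e"
  shows "(\<Sum>e | e \<in> E \<and> x \<in> e. w e / wdegree E w x) = 1"
proof -
  obtain a b where "e = {a, b}" using G assms(3) by (rule edgeE)
  with assms(3,4) obtain y where xy: "{x, y} \<in> E" by (auto simp: insert_commute)
  have "(\<Sum>e | e \<in> E \<and> x \<in> e. w e) = (\<Sum>z | {x, z} \<in> E. w {x, z})"
  proof (rule sum.reindex_bij_betw[symmetric])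
    show "bij_betw (\<lambda>z. {x, z}) {z. {x, z} \<in> E} {e. e \<in> E \<and> x \<in> e}"
    proof (rule bij_betw_imageI)
      show "inj_on (\<lambda>z. {x, z}) {z. {x, z} \<in> E}"
        by (auto simp: inj_on_def doubleton_eq_iff)
      show "(\<lambda>z. {x, z}) ` {z. {x, z} \<in> E} = {e. e \<in> E \<and> x \<in> e}"
      proof (intro equalityI subsetI)
        fix e assume "e \<in> {e. e \<in> E \<and> x \<in> e}"
        then have "e \<in> E" "x \<in> e" by auto
        moreover obtain a b where "e = {a, b}" using G \<open>e \<in> E\<close> by (rule edgeE)
        ultimately show "e \<in> (\<lambda>z. {x, z}) ` {z. {x, z} \<in> E}"
          by (auto simp: insert_commute)
      qed auto
    qed
  qed
  then show ?thesis
    using wdegree_pos[OF G w xy]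
    by (simp add: sum_divide_distrib[symmetric] wdegree_def[symmetric])
qed

text \<open>
  Double counting of incident pairs \<open>(x, e)\<close>: grouped by vertices, the transition probabilities
  out of \<open>x\<close> along edges of \<open>F\<close> are 1 minus those along the other edges of the graph.
\<close>

lemma sum_q_edge:
  assumes G: "simple_graph V E" and w: "positive_weight E w" and F: "F \<subseteq> E"
  shows "(\<Sum>e\<in>F. q_edge E w e) = real (card (\<Union>F)) - leakage E (\<Union>F) F w"
proof -
  let ?p = "\<lambda>x e. w e / wdegree E w x"
  have finE: "finite E" using finite_edges[OF G] .
  have finF: "finite F" using F finE by (rule finite_subset)
  have "\<Union>F \<subseteq> V" using F G by (auto simp: simple_graph_def)
  then have finU: "finite (\<Union>F)" using G by (auto simp: simple_graph_def intro: finite_subset)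
  have "(\<Sum>e\<in>F. q_edge E w e) = (\<Sum>e\<in>F. \<Sum>x | x \<in> \<Union>F \<and> x \<in> e. ?p x e)"
  proof (rule sum.cong[OF refl])
    fix e assume "e \<in> F"
    moreover from this have "{x. x \<in> \<Union>F \<and> x \<in> e} = e" by auto
    ultimately show "q_edge E w e = (\<Sum>x | x \<in> \<Union>F \<and> x \<in> e. ?p x e)"
      using F by (simp add: q_edge_eq_sum[OF G] subset_iff)
  qed
  also have "\<dots> = (\<Sum>x\<in>\<Union>F. \<Sum>e | e \<in> F \<and> x \<in> e. ?p x e)"
    by (rule sum.swap_restrict[OF finF finU])
  also have "\<dots> = (\<Sum>x\<in>\<Union>F. 1 - (\<Sum>e | e \<in> E \<and> x \<in> e \<and> e \<notin> F. ?p x e))"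
  proof (rule sum.cong[OF refl])
    fix x assume "x \<in> \<Union>F"
    then obtain e where "e \<in> E" "x \<in> e" using F by blast
    then have "1 = (\<Sum>e | e \<in> E \<and> x \<in> e. ?p x e)"
      by (rule sum_transition_probabilities[OF G w, symmetric])
    also have "{e. e \<in> E \<and> x \<in> e} = {e. e \<in> F \<and> x \<in> e} \<union> {e. e \<in> E \<and> x \<in> e \<and> e \<notin> F}"
      using F by blast
    also have "sum (?p x) \<dots> =
        (\<Sum>e | e \<in> F \<and> x \<in> e. ?p x e) + (\<Sum>e | e \<in> E \<and> x \<in> e \<and> e \<notin> F. ?p x e)"
      by (rule sum.union_disjoint) (use finE finF in auto)
    finally show "(\<Sum>e | e \<in> F \<and> x \<in> e. ?p x e) = 1 - (\<Sum>e | e \<in> E \<and> x \<in> e \<and> e \<notin> F. ?p x e)"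
      by simp
  qed
  finally show ?thesis by (simp add: sum_subtractf leakage_def)
qed

lemma leakage_plus_defects_le:
  assumes G: "simple_graph V E" and conn: "graph_connected V E" and w: "positive_weight E w"
    and F: "F \<subseteq> E" "F \<noteq> {}" and mad: "2 * real (card F) / real (card (\<Union>F)) = mad V E"
  shows "leakage E (\<Union>F) F w + (\<Sum>e\<in>F. triangle_defect E w e)
    \<le> 2 * real (card F) * (1 + 1 / mad V E - kappa_LLY_graph E w)"
proof -
  let ?\<kappa> = "kappa_LLY_graph E w"
  have finE: "finite E" using finite_edges[OF G] .
  have "card F \<noteq> 0" using F finite_subset[OF F(1) finE] by simp
  have "?\<kappa> \<le> 1 + 1/2 * q_edge E w e - 1/2 * triangle_defect E w e" if "e \<in> F" for e
  proof -
    have "e \<in> E" using that F by blast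
    then have "?\<kappa> \<le> kappa_LLY_edge E w e"
      unfolding kappa_LLY_graph_def using finE by (intro Min_le) auto
    also note kappa_LLY_edge_le[OF G conn w \<open>e \<in> E\<close>]
    finally show ?thesis .
  qed
  then have "(\<Sum>e\<in>F. ?\<kappa>) \<le> (\<Sum>e\<in>F. 1 + 1/2 * q_edge E w e - 1/2 * triangle_defect E w e)"
    by (rule sum_mono)
  also have "\<dots> = real (card F) + 1/2 * (\<Sum>e\<in>F. q_edge E w e)
      - 1/2 * (\<Sum>e\<in>F. triangle_defect E w e)"
    by (simp only: sum_subtractf sum.distrib sum_distrib_left[symmetric]) simp
  finally have "leakage E (\<Union>F) F w + (\<Sum>e\<in>F. triangle_defect E w e)
      \<le> 2 * real (card F) + real (card (\<Union>F)) - 2 * real (card F) * ?\<kappa>"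
    unfolding sum_q_edge[OF G w F(1)] by (simp add: field_simps)
  also have "real (card (\<Union>F)) = 2 * real (card F) * (1 / mad V E)"
    unfolding mad[symmetric] using \<open>card F \<noteq> 0\<close> by simp
  finally show ?thesis by (simp only: ring_distribs)
qed

lemma leakage_and_defects_tendsto_0:
  assumes G: "simple_graph V E" and conn: "graph_connected V E"
    and F: "F \<subseteq> E" "F \<noteq> {}" and mad: "2 * real (card F) / real (card (\<Union>F)) = mad V E"
    and max: "kappa_LLY_max E = 1 + 1 / mad V E" and ws: "maximizing_sequence E ws"
  shows "(\<lambda>j. leakage E (\<Union>F) F (ws j)) \<longlonglongrightarrow> 0"
    and "e \<in> F \<Longrightarrow> (\<lambda>j. triangle_defect E (ws j) e) \<longlonglongrightarrow> 0"
proof -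
  define gap where "gap j = 2 * real (card F) * (1 + 1 / mad V E - kappa_LLY_graph E (ws j))" for j
  have w: "positive_weight E (ws j)" for j using ws by (simp add: maximizing_sequence_def)
  have finF: "finite F" using finite_subset[OF F(1) finite_edges[OF G]] .
  have "(\<lambda>j. kappa_LLY_graph E (ws j)) \<longlonglongrightarrow> 1 + 1 / mad V E"
    using ws by (simp add: maximizing_sequence_def max)
  then have "gap \<longlonglongrightarrow> 2 * real (card F) * (1 + 1 / mad V E - (1 + 1 / mad V E))"
    unfolding gap_def by (intro tendsto_intros)
  then have gap: "gap \<longlonglongrightarrow> 0" by simp
  have le: "leakage E (\<Union>F) F (ws j) + (\<Sum>e\<in>F. triangle_defect E (ws j) e) \<le> gap j" for j
    unfolding gap_def by (rule leakage_plus_defects_le[OF G conn w F mad])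
  have defect: "0 \<le> triangle_defect E (ws j) e" if "e \<in> F" for e j
    using triangle_defect_nonneg[OF G w] that F(1) by blast
  have leak: "0 \<le> leakage E (\<Union>F) F (ws j)" for j by (rule leakage_nonneg[OF w])
  show "(\<lambda>j. leakage E (\<Union>F) F (ws j)) \<longlonglongrightarrow> 0"
  proof (rule real_tendsto_sandwich[OF _ _ tendsto_const gap]; intro always_eventually allI)
    fix j
    have "0 \<le> (\<Sum>e\<in>F. triangle_defect E (ws j) e)" by (intro sum_nonneg defect)
    then show "leakage E (\<Union>F) F (ws j) \<le> gap j" using le[of j] by simp
  qed (rule leak)
  show "(\<lambda>j. triangle_defect E (ws j) e) \<longlonglongrightarrow> 0" if "e \<in> F"
  proof (rule real_tendsto_sandwich[OF _ _ tendsto_const gap]; intro always_eventually allI)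
    fix j
    have "triangle_defect E (ws j) e \<le> (\<Sum>e\<in>F. triangle_defect E (ws j) e)"
      by (intro member_le_sum that finF) (use defect in auto)
    then show "triangle_defect E (ws j) e \<le> gap j" using le[of j] leak[of j] by simp
  qed (rule defect[OF that])
qed

theorem theorem4p2:
  fixes V :: "'a set" and E :: "'a set set"
  assumes "simple_graph V E" and "graph_connected V E"
  shows "(\<forall>w e. positive_weight E w \<longrightarrow> e \<in> E \<longrightarrow>
            kappa_LLY_edge E w e \<le> 1 + 1/2 * q_edge E w e - 1/2 * triangle_defect E w e \<and>
            kappa_LLY_edge E w e \<le> 1 + q_edge E w e / 2) \<and>
         (\<forall>F. F \<subseteq> E \<longrightarrow> F \<noteq> {} \<longrightarrow> 2 * real (card F) / real (card (\<Union>F)) = mad V E \<longrightarrow>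
            (\<forall>w. positive_weight E w \<longrightarrow>
               leakage E (\<Union>F) F w + (\<Sum>e\<in>F. triangle_defect E w e)
                 \<le> 2 * real (card F) * (1 + 1 / mad V E - kappa_LLY_graph E w)) \<and>
            (kappa_LLY_max E = 1 + 1 / mad V E \<longrightarrow>
               (\<forall>ws. maximizing_sequence E ws \<longrightarrow>
                  (\<lambda>j. leakage E (\<Union>F) F (ws j)) \<longlonglongrightarrow> 0 \<and>
                  (\<forall>e\<in>F. (\<lambda>j. triangle_defect E (ws j) e) \<longlonglongrightarrow> 0))))"
proof (intro conjI allI impI ballI)
  fix w e assume we: "positive_weight E w" "e \<in> E"
  show *: "kappa_LLY_edge E w e \<le> 1 + 1/2 * q_edge E w e - 1/2 * triangle_defect E w e"
    using kappa_LLY_edge_le[OF assms we] .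
  with triangle_defect_nonneg[OF assms(1) we]
  show "kappa_LLY_edge E w e \<le> 1 + q_edge E w e / 2" by simp
qed (rule leakage_plus_defects_le[OF assms] leakage_and_defects_tendsto_0[OF assms]; assumption)+

end
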